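(* Consider biased SGD, $x_{k+1}=x_k-\alpha_k(u_k+e_k)$ with $u_k=\nabla f_{i_k}(x_k)$ and $\|e_k\|^2\le\delta^2\|u_k\|^2+c^2$, applied to $g=\frac1n\sum_{i=1}^n f_i$ with $g\in\mathcal{S}(m,\infty)$ for some $m>0$, and let $x_\star$ be the unique global minimizer of $g$. Suppose that one of the four conditions I–IV on the $f_i$ listed in the context holds, and let $M=\begin{bmatrix} M_{11} & M_{12} \\ M_{21} & M_{22} \end{bmatrix}$ and $G$ be the corresponding matrix and constant. If for a given $k$ there exist nonnegative real numbers $\lambda_k,\nu_k,\mu_k,\rho_k$ such that $$\begin{bmatrix} -\rho_k^2 - 2\nu_k m + \lambda_k M_{11} & \nu_k + \lambda_k M_{12} & -1 & 0 \\ \nu_k +\lambda_k M_{21} & \mu_k \delta^2 +\lambda_k M_{22} & \alpha_k & 0 \\ -1 & \alpha_k & -1 & \alpha_k \\ 0 & 0 & \alpha_k & -\mu_k \end{bmatrix}\preceq 0$$ (i.e. this symmetric matrix is negative semidefinite), then the biased SGD iterates satisfy $$\mathbb{E}\|x_{k+1}-x_\star\|^2\le\rho_k^2\,\mathbb{E}\|x_k-x_\star\|^2+(2\lambda_kG^2+\mu_kc^2).$$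
   Context: Setting. $p,n\ge1$ are integers, $f_1,\dots,f_n:\mathbb{R}^p\to\mathbb{R}$ are differentiable, and $g(x)=\frac1n\sum_{i=1}^n f_i(x)$. For $m>0$, $g\in\mathcal{S}(m,\infty)$ means that $g$ is differentiable, has a global minimizer $x_\star$, and $(x-x_\star)^{\mathsf T}\nabla g(x)\ge m\|x-x_\star\|^2$ for all $x\in\mathbb{R}^p$ (hence $x_\star$ is the unique minimizer and unique stationary point). Biased SGD. $x_0$ is a random vector with $\mathbb{E}\|x_0\|^2<\infty$, the $\alpha_k$ are deterministic real stepsizes, and $x_{k+1}=x_k-\alpha_k(u_k+e_k)$ with $u_k=\nabla f_{i_k}(x_k)$. The indices $i_k$ are IID uniform on $\{1,\dots,n\}$ and $i_k$ is independent of $x_k$. The $e_k$ are random vectors that are otherwise arbitrary (possibly adversarial) but satisfy $\|e_k\|^2\le\delta^2\|u_k\|^2+c^2$ for every $k$, where $\delta,c\ge0$ are fixed constants. Function class. For $0\le m\le L$, $0<L<\infty$, $\mathcal{F}(m,L)$ is the set of differentiable $f:\mathbb{R}^p\to\mathbb{R}$ with $-2m\|x-y\|^2+2(1+\frac mL)(x-y)^{\mathsf T}(\nabla f(x)-\nabla f(y))-\frac2L\|\nabla f(x)-\nabla f(y)\|^2\ge0$ for all $x,y$. $\mathcal{F}(0,L)$ is the class of convex $L$-smooth functions. A differentiable $f$ is $L$-smooth if $\|\nabla f(x)-\nabla f(y)\|\le L\|x-y\|$ for all $x,y$. The four cases (each condition is required for every $i$; $m$ is the same as in $g\in\mathcal{S}(m,\infty)$;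 $0<L<\infty$, $\beta\ge0$; $G\ge0$): I. $\|\nabla f_i(x)-mx\|\le\beta$ for all $x$; $M=\begin{bmatrix} -m^2 & m \\ m & -1 \end{bmatrix}$, $G^2=\beta^2+m^2\|x_\star\|^2$. II. $f_i$ is $L$-smooth (not necessarily convex); $M=\begin{bmatrix} 2L^2 & 0 \\ 0 & -1 \end{bmatrix}$, $G^2=\frac1n\sum_{i=1}^n\|\nabla f_i(x_\star)\|^2$. III. $f_i\in\mathcal{F}(0,L)$; $M=\begin{bmatrix} 0 & L \\ L & -1 \end{bmatrix}$, $G^2=\frac1n\sum_{i=1}^n\|\nabla f_i(x_\star)\|^2$. IV. $f_i\in\mathcal{F}(m,L)$; $M=\begin{bmatrix} -2mL & L+m \\ L+m & -1 \end{bmatrix}$, $G^2=\frac1n\sum_{i=1}^n\|\nabla f_i(x_\star)\|^2$. *)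

theory Defs
  imports "HOL-Probability.Probability"
begin

text \<open>Meaningful only where \<open>f\<close> is differentiable; elsewhere the value is unspecified.\<close>

definition grad :: "('a::real_inner \<Rightarrow> real) \<Rightarrow> 'a \<Rightarrow> 'a" where
  "grad f x = (THE D. GDERIV f x :> D)"

definition avg_fun :: "nat \<Rightarrow> (nat \<Rightarrow> 'a \<Rightarrow> real) \<Rightarrow> 'a \<Rightarrow> real" where
  "avg_fun n f x = (1 / real n) * (\<Sum>i=1..n. f i x)"

definition global_minimizer :: "('a \<Rightarrow> real) \<Rightarrow> 'a \<Rightarrow> bool" where
  "global_minimizer g xs \<longleftrightarrow> (\<forall>x. g xs \<le> g x)"

text \<open>The class \<open>S(m, \<infinity>)\<close>.\<close>

definition class_S_inf :: "real \<Rightarrow> (real ^ 'p \<Rightarrow> real) set" where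
  "class_S_inf m = {g. (\<forall>x. g differentiable (at x)) \<and>
     (\<exists>xs. global_minimizer g xs \<and>
        (\<forall>x. (x - xs) \<bullet> grad g x \<ge> m * (norm (x - xs))\<^sup>2))}"

definition class_F :: "real \<Rightarrow> real \<Rightarrow> (real ^ 'p \<Rightarrow> real) set" where
  "class_F m L = {f. (\<forall>x. f differentiable (at x)) \<and>
     (\<forall>x y. - 2 * m * (norm (x - y))\<^sup>2
        + 2 * (1 + m / L) * ((x - y) \<bullet> (grad f x - grad f y))
        - (2 / L) * (norm (grad f x - grad f y))\<^sup>2 \<ge> 0)}"

definition L_smooth :: "real \<Rightarrow> (real ^ 'p \<Rightarrow> real) \<Rightarrow> bool" where
  "L_smooth L f \<longleftrightarrow> (\<forall>x. f differentiable (at x)) \<and>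
     (\<forall>x y. norm (grad f x - grad f y) \<le> L * norm (x - y))"

text \<open>
  Each predicate below bundles a condition on the \<open>f i\<close> with the matrix \<open>M\<close> and the
  constant \<open>G\<close> (determined through \<open>G \<ge> 0\<close> and \<open>G\<^sup>2\<close>) that belong to it.
\<close>

definition case_I ::
  "nat \<Rightarrow> (nat \<Rightarrow> real ^ 'p \<Rightarrow> real) \<Rightarrow> real ^ 'p \<Rightarrow> real \<Rightarrow> real \<Rightarrow> real ^ 2 ^ 2 \<Rightarrow> real \<Rightarrow> bool"
  where "case_I n f xs m \<beta> M G \<longleftrightarrow>
     0 \<le> \<beta> \<and> (\<forall>i\<in>{1..n}. \<forall>x. norm (grad (f i) x - m *\<^sub>R x) \<le> \<beta>) \<and>
     M = vector [vector [- m\<^sup>2, m],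
                 vector [m, - 1]] \<and>
     0 \<le> G \<and> G\<^sup>2 = \<beta>\<^sup>2 + m\<^sup>2 * (norm xs)\<^sup>2"

definition case_II ::
  "nat \<Rightarrow> (nat \<Rightarrow> real ^ 'p \<Rightarrow> real) \<Rightarrow> real ^ 'p \<Rightarrow> real \<Rightarrow> real ^ 2 ^ 2 \<Rightarrow> real \<Rightarrow> bool"
  where "case_II n f xs L M G \<longleftrightarrow>
     0 < L \<and> (\<forall>i\<in>{1..n}. L_smooth L (f i)) \<and>
     M = vector [vector [2 * L\<^sup>2, 0],
                 vector [0, - 1]] \<and>
     0 \<le> G \<and> G\<^sup>2 = (1 / real n) * (\<Sum>i=1..n. (norm (grad (f i) xs))\<^sup>2)"

definition case_III ::
  "nat \<Rightarrow> (nat \<Rightarrow> real ^ 'p \<Rightarrow> real) \<Rightarrow> real ^ 'p \<Rightarrow> real \<Rightarrow> real ^ 2 ^ 2 \<Rightarrow> real \<Rightarrow> bool"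
  where "case_III n f xs L M G \<longleftrightarrow>
     0 < L \<and> (\<forall>i\<in>{1..n}. f i \<in> class_F 0 L) \<and>
     M = vector [vector [0, L],
                 vector [L, - 1]] \<and>
     0 \<le> G \<and> G\<^sup>2 = (1 / real n) * (\<Sum>i=1..n. (norm (grad (f i) xs))\<^sup>2)"

definition case_IV ::
  "nat \<Rightarrow> (nat \<Rightarrow> real ^ 'p \<Rightarrow> real) \<Rightarrow> real ^ 'p \<Rightarrow> real \<Rightarrow> real \<Rightarrow> real ^ 2 ^ 2 \<Rightarrow> real \<Rightarrow> bool"
  where "case_IV n f xs m L M G \<longleftrightarrow>
     0 \<le> m \<and> m \<le> L \<and> 0 < L \<and> (\<forall>i\<in>{1..n}. f i \<in> class_F m L) \<and>
     M = vector [vector [- 2 * m * L, L + m],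
                 vector [L + m, - 1]] \<and>
     0 \<le> G \<and> G\<^sup>2 = (1 / real n) * (\<Sum>i=1..n. (norm (grad (f i) xs))\<^sup>2)"

definition neg_semidefinite :: "real ^ 'n ^ 'n \<Rightarrow> bool" where
  "neg_semidefinite A \<longleftrightarrow> transpose A = A \<and> (\<forall>v. v \<bullet> (A *v v) \<le> 0)"

definition lmi_matrix ::
  "real ^ 2 ^ 2 \<Rightarrow> real \<Rightarrow> real \<Rightarrow> real \<Rightarrow> real \<Rightarrow> real \<Rightarrow> real \<Rightarrow> real \<Rightarrow> real ^ 4 ^ 4" where
  "lmi_matrix M m \<delta> \<alpha> lam \<nu> \<mu> \<rho> = vector [
     vector [- \<rho>\<^sup>2 - 2 * \<nu> * m + lam * M$1$1, \<nu> + lam * M$1$2,          - 1, 0],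
     vector [\<nu> + lam * M$2$1,                \<mu> * \<delta>\<^sup>2 + lam * M$2$2,    \<alpha>,  0],
     vector [- 1,                            \<alpha>,                       - 1, \<alpha>],
     vector [0,                              0,                       \<alpha>,   - \<mu>]]"

text \<open>
  The library predicate \<open>indep_var\<close> requires both variables to have the same value type, so
  independence of \<open>i k\<close> and \<open>x k\<close> is stated through the events they generate, exactly as in
  the definition of \<open>indep_vars\<close>.
\<close>

locale biased_sgd = prob_space P
  for P :: "'w measure" +
  fixes n :: nat
    and f :: "nat \<Rightarrow> real ^ 'p \<Rightarrow> real"
    and \<alpha> :: "nat \<Rightarrow> real"
    and \<delta> c :: real
    and i :: "nat \<Rightarrow> 'w \<Rightarrow> nat"
    and x u e :: "nat \<Rightarrow> 'w \<Rightarrow> real ^ 'p"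
  assumes n_pos: "1 \<le> n"
    and f_differentiable: "\<And>j y. j \<in> {1..n} \<Longrightarrow> f j differentiable (at y)"
    and \<delta>_nonneg: "0 \<le> \<delta>"
    and c_nonneg: "0 \<le> c"
    and x0_rv: "x 0 \<in> borel_measurable P"
    and x0_square_integrable: "integrable P (\<lambda>\<omega>. (norm (x 0 \<omega>))\<^sup>2)"
    and e_rv: "\<And>k. e k \<in> borel_measurable P"
    and i_indep: "indep_vars (\<lambda>_. count_space {1..n}) i UNIV"
    and i_uniform: "\<And>k. distr P (count_space {1..n}) (i k) = uniform_count_measure {1..n}"
    and i_indep_x: "\<And>k. indep_set {i k -` A \<inter> space P | A. A \<in> sets (count_space {1..n})}
                                  {x k -` B \<inter> space P | B. B \<in> sets borel}"
    and u_eq: "\<And>k \<omega>. \<omega> \<in> space P \<Longrightarrow> u k \<omega> = grad (f (i k \<omega>)) (x k \<omega>)"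
    and x_Suc: "\<And>k \<omega>. \<omega> \<in> space P \<Longrightarrow> x (Suc k) \<omega> = x k \<omega> - \<alpha> k *\<^sub>R (u k \<omega> + e k \<omega>)"
    and e_bound: "\<And>k. AE \<omega> in P. (norm (e k \<omega>))\<^sup>2 \<le> \<delta>\<^sup>2 * (norm (u k \<omega>))\<^sup>2 + c\<^sup>2"

end

theory Submission
  imports Defs
begin

text \<open>
  Write \<open>y = x\<^sub>k - x\<^sub>\<star>\<close>. Evaluating the matrix inequality coordinatewise at
  \<open>(y, u\<^sub>k, -(x\<^sub>k\<^sub>+\<^sub>1 - x\<^sub>\<star>), e\<^sub>k)\<close> and summing over the coordinates gives
  \<open>\<parallel>x\<^sub>k\<^sub>+\<^sub>1 - x\<^sub>\<star>\<parallel>\<^sup>2 \<le> \<rho>\<^sup>2 \<parallel>y\<parallel>\<^sup>2 + 2 \<nu> (m \<parallel>y\<parallel>\<^sup>2 - y \<bullet> u\<^sub>k) - \<lambda> q(y, u\<^sub>k) + \<mu> (\<parallel>e\<^sub>k\<parallel>\<^sup>2 - \<delta>\<^sup>2 \<parallel>u\<^sub>k\<parallel>\<^sup>2)\<close>,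
  where \<open>q\<close> is the quadratic form of \<open>M\<close>. The last term is at most \<open>\<mu> c\<^sup>2\<close>. Since \<open>i\<^sub>k\<close> is uniform and
  independent of \<open>x\<^sub>k\<close>, taking the expectation replaces the terms in \<open>u\<^sub>k\<close> by averages over the
  \<open>f\<^sub>j\<close>: the \<open>\<nu>\<close>-term becomes nonpositive because \<open>g \<in> S(m, \<infinity>)\<close>, and in each of the four cases the
  average of \<open>q\<close> is at least \<open>-2 G\<^sup>2\<close>. In all cases the gradients grow at most linearly, so the
  iterates stay square integrable.
\<close>

section \<open>Gradients: uniqueness, stationarity and measurability\<close>

text \<open>The derivative is a linear functional, and its adjoint applied to \<open>1\<close> is
  the vector representing it. Uniqueness of the derivative makes the \<open>THE\<close> in
  \<open>grad\<close> well defined.\<close>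

lemma GDERIV_grad:
  fixes f :: "'a::euclidean_space \<Rightarrow> real"
  assumes "f differentiable (at x)"
  shows "GDERIV f x :> grad f x"
proof -
  obtain f' where f': "(f has_derivative f') (at x)"
    using assms by (auto simp: differentiable_def)
  then have "linear f'" by (rule has_derivative_linear)
  then have "f' = (\<lambda>h. h \<bullet> adjoint f' 1)"
    by (auto simp: adjoint_works)
  then have "GDERIV f x :> adjoint f' 1"
    using f' by (simp add: gderiv_def)
  moreover from this have "D = adjoint f' 1" if "GDERIV f x :> D" for D
  proof -
    have "(\<lambda>h. h \<bullet> D) = (\<lambda>h. h \<bullet> adjoint f' 1)"
      using that \<open>GDERIV f x :> adjoint f' 1\<close>
      unfolding gderiv_def by (rule has_derivative_unique)
    then show ?thesis
      by (metis vector_eq_rdot inner_commute)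
  qed
  ultimately show ?thesis
    unfolding grad_def by (metis theI)
qed

lemma grad_eqI:
  fixes f :: "'a::euclidean_space \<Rightarrow> real"
  assumes "GDERIV f x :> D"
  shows "grad f x = D"
proof -
  have "f differentiable (at x)"
    using assms by (auto simp: gderiv_def differentiable_def)
  then have "(\<lambda>h. h \<bullet> grad f x) = (\<lambda>h. h \<bullet> D)"
    using GDERIV_grad assms unfolding gderiv_def by (blast intro: has_derivative_unique)
  then show ?thesis
    by (metis vector_eq_rdot inner_commute)
qed

lemma grad_avg_fun:
  fixes f :: "nat \<Rightarrow> 'a::euclidean_space \<Rightarrow> real"
  assumes "\<And>j. j \<in> {1..n} \<Longrightarrow> f j differentiable (at x)"
  shows "grad (avg_fun n f) x = (1 / real n) *\<^sub>R (\<Sum>j=1..n. grad (f j) x)"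
proof (rule grad_eqI)
  have "(f j has_derivative (\<lambda>h. h \<bullet> grad (f j) x)) (at x)" if "j \<in> {1..n}" for j
    using GDERIV_grad[OF assms[OF that]] by (simp add: gderiv_def)
  then have "((\<lambda>y. (1 / real n) * (\<Sum>j=1..n. f j y)) has_derivative
      (\<lambda>h. (1 / real n) * (\<Sum>j=1..n. h \<bullet> grad (f j) x))) (at x)"
    by (intro has_derivative_mult_right has_derivative_sum)
  then show "GDERIV (avg_fun n f) x :> (1 / real n) *\<^sub>R (\<Sum>j=1..n. grad (f j) x)"
    unfolding gderiv_def avg_fun_def[abs_def] by (simp add: inner_sum_right)
qed

lemma grad_global_minimizer:
  fixes g :: "'a::euclidean_space \<Rightarrow> real"
  assumes "g differentiable (at x)" and "global_minimizer g x"
  shows "grad g x = 0"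
proof -
  have "(g has_derivative (\<lambda>h. h \<bullet> grad g x)) (at x)"
    using GDERIV_grad[OF assms(1)] by (simp add: gderiv_def)
  then have "(\<lambda>h. h \<bullet> grad g x) = (\<lambda>h. 0)"
    using assms(2)
    by (intro differential_zero_maxmin[of x UNIV g]) (auto simp: global_minimizer_def)
  then show ?thesis
    by (metis inner_eq_zero_iff)
qed

text \<open>The gradient may be discontinuous (case I permits this), but each coordinate is a
  pointwise limit of difference quotients of \<open>f\<close>, which are measurable in
  \<open>x\<close>.\<close>

lemma borel_measurable_grad:
  fixes f :: "'a::euclidean_space \<Rightarrow> real"
  assumes "\<And>x. f differentiable (at x)"
  shows "grad f \<in> borel_measurable borel"
proof (subst borel_measurable_euclidean_space, intro ballI)
  fix b :: 'a assume "b \<in> Basis"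
  have "continuous_on UNIV f"
    using assms by (auto intro!: continuous_at_imp_continuous_on differentiable_imp_continuous_within)
  then have [measurable]: "f \<in> borel_measurable borel"
    by (rule borel_measurable_continuous_onI)
  show "(\<lambda>x. grad f x \<bullet> b) \<in> borel_measurable borel"
  proof (rule borel_measurable_LIMSEQ_real)
    fix x
    have "((\<lambda>t. f (x + t *\<^sub>R b)) has_derivative (\<lambda>t. (t *\<^sub>R b) \<bullet> grad f x)) (at 0)"
      using GDERIV_grad[OF assms, of x]
      by (intro has_derivative_compose[where f = "\<lambda>t. x + t *\<^sub>R b" and g = f])
         (auto simp: gderiv_def intro!: derivative_eq_intros)
    then have "((\<lambda>t. f (x + t *\<^sub>R b)) has_field_derivative (grad f x \<bullet> b)) (at 0)"
      by (simp add: has_field_derivative_def inner_commute[of _ b] mult_commute_abs)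
    then have "((\<lambda>h. (f (x + h *\<^sub>R b) - f x) / h) \<longlongrightarrow> grad f x \<bullet> b) (at 0)"
      by (simp add: DERIV_def)
    \<comment> \<open>\<open>Suc k\<close> keeps every step nonzero and finite, as the punctured
      filter \<open>at 0\<close> demands.\<close>
    moreover have "filterlim (\<lambda>k. inverse (real (Suc k))) (at 0) sequentially"
      using LIMSEQ_inverse_real_of_nat by (simp add: filterlim_at)
    ultimately show "(\<lambda>k. (f (x + inverse (real (Suc k)) *\<^sub>R b) - f x) / inverse (real (Suc k)))
        \<longlonglongrightarrow> grad f x \<bullet> b"
      by (rule filterlim_compose)
  qed measurable
qed

section \<open>Factoring expectations under independence\<close>

text \<open>Independence of the generated events passes to the real variables
  \<open>indicator S (J \<omega>)\<close> and \<open>\<phi> (X \<omega>)\<close>, and the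
  expectation of a product of independent integrable variables factors.\<close>

lemma (in prob_space) expectation_indicator_mult_indep:
  fixes X :: "'a \<Rightarrow> 'b::topological_space" and \<phi> :: "'b \<Rightarrow> real"
  assumes indep: "indep_set {J -` A \<inter> space M | A. A \<in> sets N}
                            {X -` B \<inter> space M | B. B \<in> sets borel}"
    and J: "J \<in> measurable M N" and X: "X \<in> borel_measurable M"
    and \<phi>: "\<phi> \<in> borel_measurable borel" and int: "integrable M (\<lambda>\<omega>. \<phi> (X \<omega>))"
    and S: "S \<in> sets N"
  shows "integrable M (\<lambda>\<omega>. indicator S (J \<omega>) * \<phi> (X \<omega>))"
    and "expectation (\<lambda>\<omega>. indicator S (J \<omega>) * \<phi> (X \<omega>)) =
           prob (J -` S \<inter> space M) * expectation (\<lambda>\<omega>. \<phi> (X \<omega>))"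
proof -
  note [measurable] = J X \<phi> S
  let ?I = "\<lambda>\<omega>. indicator S (J \<omega>) :: real" and ?Y = "\<lambda>\<omega>. \<phi> (X \<omega>)"
  let ?GJ = "{J -` A \<inter> space M | A. A \<in> sets N}"
  let ?GX = "{X -` B \<inter> space M | B. B \<in> sets borel}"
  have sub: "{?I -` A \<inter> space M | A. A \<in> sets borel} \<subseteq> ?GJ"
  proof clarify
    fix A :: "real set" assume "A \<in> sets borel"
    then have "(indicator S :: _ \<Rightarrow> real) -` A \<inter> space N \<in> sets N" by measurable
    moreover have "?I -` A \<inter> space M = J -` ((indicator S :: _ \<Rightarrow> real) -` A \<inter> space N) \<inter> space M"
      using measurable_space[OF J] by auto
    ultimately show "\<exists>A'. ?I -` A \<inter> space M = J -` A' \<inter> space M \<and> A' \<in> sets N"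
      by blast
  qed
  have sub': "{?Y -` A \<inter> space M | A. A \<in> sets borel} \<subseteq> ?GX"
  proof clarify
    fix A :: "real set" assume A: "A \<in> sets borel"
    have "\<phi> -` A \<in> sets borel" using measurable_sets[OF \<phi> A] by simp
    then show "\<exists>B. ?Y -` A \<inter> space M = X -` B \<inter> space M \<and> B \<in> sets borel"
      by (intro exI[of _ "\<phi> -` A"]) auto
  qed
  have ind: "indep_set {?I -` A \<inter> space M | A. A \<in> sets borel} {?Y -` A \<inter> space M | A. A \<in> sets borel}"
    using indep sub sub' unfolding indep_set_def
    by (elim indep_sets_mono_sets) (auto split: bool.split)
  \<comment> \<open>\<open>indep_var\<close> concerns the generated sigma-algebras. Independence of
    the preimage families extends to these because the families are closed under
    intersection.\<close>
  have stable: "Int_stable {Z -` A \<inter> space M | A. A \<in> sets borel}" for Z :: "'a \<Rightarrow> real"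
  proof (rule Int_stableI, clarify)
    fix A B :: "real set" assume "A \<in> sets borel" "B \<in> sets borel"
    then show "\<exists>C. (Z -` A \<inter> space M) \<inter> (Z -` B \<inter> space M) = Z -` C \<inter> space M \<and> C \<in> sets borel"
      by (intro exI[of _ "A \<inter> B"]) auto
  qed
  have iv: "indep_var borel ?I borel ?Y"
    unfolding indep_var_eq using indep_set_sigma_sets[OF ind stable stable] by simp
  have I: "integrable M ?I"
    by (rule integrable_const_bound[where B = 1]) (auto simp: indicator_def)
  show "integrable M (\<lambda>\<omega>. ?I \<omega> * ?Y \<omega>)"
    by (rule indep_var_integrable[OF iv I int])
  have "expectation ?I = expectation (indicator (J -` S \<inter> space M))"
    by (intro Bochner_Integration.integral_cong) (auto simp: indicator_def)
  also have "\<dots> = prob (J -` S \<inter> space M)" by simp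
  finally show "expectation (\<lambda>\<omega>. ?I \<omega> * ?Y \<omega>) = prob (J -` S \<inter> space M) * expectation ?Y"
    using indep_var_lebesgue_integral[OF iv I int] by simp
qed

section \<open>The quadratic form and the matrix inequality\<close>

text \<open>This is the form of the block matrix whose blocks are the entries of \<open>M\<close>
  times the identity, at the stacked vector \<open>(y, v)\<close>.\<close>

definition quad_form :: "real ^ 2 ^ 2 \<Rightarrow> 'a::real_inner \<Rightarrow> 'a \<Rightarrow> real" where
  "quad_form M y v = M$1$1 * (norm y)\<^sup>2 + (M$1$2 + M$2$1) * (y \<bullet> v) + M$2$2 * (norm v)\<^sup>2"

lemma vector_4 [simp]:
  "(vector [w, x, y, z] :: 'a::zero ^ 4) $ 1 = w"
  "(vector [w, x, y, z] :: 'a::zero ^ 4) $ 2 = x"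
  "(vector [w, x, y, z] :: 'a::zero ^ 4) $ 3 = y"
  "(vector [w, x, y, z] :: 'a::zero ^ 4) $ 4 = z"
  unfolding vector_def by simp_all

lemma lmi_real:
  fixes a b d :: real
  assumes "neg_semidefinite (lmi_matrix M m \<delta> \<alpha> lam \<nu> \<mu> \<rho>)"
  shows "(a - \<alpha> * (b + d))\<^sup>2 \<le> \<rho>\<^sup>2 * a\<^sup>2 + 2 * \<nu> * (m * a\<^sup>2 - a * b)
    - lam * (M$1$1 * a\<^sup>2 + (M$1$2 + M$2$1) * (a * b) + M$2$2 * b\<^sup>2) + \<mu> * (d\<^sup>2 - \<delta>\<^sup>2 * b\<^sup>2)"
proof -
  \<comment> \<open>The third coordinate maximizes the quadratic form for given other coordinates.\<close>
  let ?v = "vector [a, b, - (a - \<alpha> * (b + d)), d] :: real ^ 4"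
  have "?v \<bullet> (lmi_matrix M m \<delta> \<alpha> lam \<nu> \<mu> \<rho> *v ?v) \<le> 0"
    using assms by (simp add: neg_semidefinite_def)
  then show ?thesis
    by (simp add: lmi_matrix_def inner_vec_def matrix_vector_mult_def sum_4
        algebra_simps power2_eq_square)
qed

text \<open>Every term of \<open>lmi_real\<close> is quadratic in \<open>(a, b, d)\<close>, so
  summing over coordinates turns squares into squared norms and products into inner
  products.\<close>

lemma lmi_vec:
  fixes y v d :: "real ^ 'p"
  assumes "neg_semidefinite (lmi_matrix M m \<delta> \<alpha> lam \<nu> \<mu> \<rho>)"
  shows "(norm (y - \<alpha> *\<^sub>R (v + d)))\<^sup>2 \<le> \<rho>\<^sup>2 * (norm y)\<^sup>2 + 2 * \<nu> * (m * (norm y)\<^sup>2 - y \<bullet> v)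
    - lam * quad_form M y v + \<mu> * ((norm d)\<^sup>2 - \<delta>\<^sup>2 * (norm v)\<^sup>2)"
proof -
  have n2: "(norm w)\<^sup>2 = (\<Sum>j\<in>UNIV. (w $ j)\<^sup>2)" for w :: "real ^ 'p"
    unfolding dot_square_norm[symmetric] by (simp add: inner_vec_def power2_eq_square)
  have "(\<Sum>j\<in>UNIV. (y $ j - \<alpha> * (v $ j + d $ j))\<^sup>2) \<le>
    (\<Sum>j\<in>UNIV. \<rho>\<^sup>2 * (y$j)\<^sup>2 + 2 * \<nu> * (m * (y$j)\<^sup>2 - y$j * v$j)
    - lam * (M$1$1 * (y$j)\<^sup>2 + (M$1$2 + M$2$1) * (y$j * v$j) + M$2$2 * (v$j)\<^sup>2)
    + \<mu> * ((d$j)\<^sup>2 - \<delta>\<^sup>2 * (v$j)\<^sup>2))"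
    by (intro sum_mono lmi_real assms)
  then show ?thesis
    by (simp add: quad_form_def n2 inner_vec_def sum.distrib sum_subtractf sum_distrib_left[symmetric])
qed

text \<open>The parallelogram law with one square dropped. Its factor 2 is the one in front of
  \<open>lam * G\<^sup>2\<close> in the theorem.\<close>

lemma norm_add_squared_le: "(norm (a + b))\<^sup>2 \<le> 2 * (norm a)\<^sup>2 + 2 * (norm b)\<^sup>2"
  for a b :: "'a::real_inner"
proof -
  have "(norm (a + b))\<^sup>2 + (norm (a - b))\<^sup>2 = 2 * (norm a)\<^sup>2 + 2 * (norm b)\<^sup>2"
    by (simp add: dot_square_norm[symmetric] algebra_simps inner_commute)
  then show ?thesis
    by (smt (verit) zero_le_power2)
qed

section \<open>Function classes and the four cases\<close>

text \<open>Multiplying the defining inequality by \<open>L / 2\<close> clears the denominators.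
  Twice the right-hand side carries the coefficients \<open>- 2 * m * L\<close> and
  \<open>2 * (L + m)\<close> of the form in case IV.\<close>

lemma class_F_ineq:
  fixes f :: "real ^ 'p \<Rightarrow> real"
  assumes "f \<in> class_F m L" and "0 < L"
  shows "(norm (grad f x - grad f y))\<^sup>2
    \<le> (L + m) * ((x - y) \<bullet> (grad f x - grad f y)) - m * L * (norm (x - y))\<^sup>2"
proof -
  have "0 \<le> (L / 2) * (- 2 * m * (norm (x - y))\<^sup>2
        + 2 * (1 + m / L) * ((x - y) \<bullet> (grad f x - grad f y))
        - (2 / L) * (norm (grad f x - grad f y))\<^sup>2)"
    using assms by (intro mult_nonneg_nonneg) (auto simp: class_F_def)
  also have "\<dots> = (L + m) * ((x - y) \<bullet> (grad f x - grad f y)) - m * L * (norm (x - y))\<^sup>2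
    - (norm (grad f x - grad f y))\<^sup>2"
    using assms(2) by (simp add: field_simps)
  finally show ?thesis by simp
qed

text \<open>After the \<open>m * L\<close> term is discarded, Cauchy-Schwarz bounds the square by a
  product with a common factor, which cancels. Any Lipschitz constant would serve, since only the
  growth of the gradient is derived from it.\<close>

lemma class_F_lipschitz:
  fixes f :: "real ^ 'p \<Rightarrow> real"
  assumes "f \<in> class_F m L" and "0 < L" and "0 \<le> m"
  shows "norm (grad f x - grad f y) \<le> (L + m) * norm (x - y)"
proof (cases "grad f x = grad f y")
  case False
  have "(norm (grad f x - grad f y))\<^sup>2 \<le> (L + m) * ((x - y) \<bullet> (grad f x - grad f y))"
    using class_F_ineq[OF assms(1,2), of x y] assms by (smt (verit) mult_nonneg_nonneg zero_le_power2)
  also have "\<dots> \<le> (L + m) * (norm (x - y) * norm (grad f x - grad f y))"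
    using assms by (intro mult_left_mono norm_cauchy_schwarz) auto
  finally show ?thesis
    using False by (simp add: power2_eq_square mult.assoc[symmetric])
qed (use assms in auto)

lemma case_IV_of_case_III: "case_III n f xs L M G \<Longrightarrow> case_IV n f xs 0 L M G"
  by (simp add: case_III_def case_IV_def)

lemma lipschitz_growth:
  fixes h :: "'a::real_inner \<Rightarrow> 'b::real_inner"
  assumes "\<And>x y. norm (h x - h y) \<le> K * norm (x - y)"
  shows "(norm (h z))\<^sup>2 \<le> 2 * (norm (h 0))\<^sup>2 + 2 * K\<^sup>2 * (norm z)\<^sup>2"
proof -
  have "(norm (h z - h 0))\<^sup>2 \<le> (K * norm z)\<^sup>2"
    using assms[of z 0] by (intro power_mono) auto
  then show ?thesis
    using norm_add_squared_le[of "h 0" "h z - h 0"] by (simp add: power_mult_distrib)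
qed

text \<open>This serves integrability: it carries square integrability from an iterate to the
  gradients evaluated there. Case I compares the gradient with \<open>m *\<^sub>R z\<close>; the
  other cases are Lipschitz.\<close>

lemma grad_quadratic_growth:
  fixes f :: "nat \<Rightarrow> real ^ 'p \<Rightarrow> real"
  assumes "case_I n f xs m \<beta> M G \<or> case_II n f xs L M G \<or>
           case_III n f xs L M G \<or> case_IV n f xs m L M G"
    and j: "j \<in> {1..n}"
  shows "\<exists>A B. \<forall>z. (norm (grad (f j) z))\<^sup>2 \<le> A + B * (norm z)\<^sup>2"
proof -
  have lip: ?thesis if "\<And>x y. norm (grad (f j) x - grad (f j) y) \<le> K * norm (x - y)" for K
    by (rule exI[of _ "2 * (norm (grad (f j) 0))\<^sup>2"], rule exI[of _ "2 * K\<^sup>2"])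
       (simp add: lipschitz_growth[OF that])
  \<comment> \<open>\<open>m'\<close> is separate from \<open>m\<close> so that the choice
    \<open>m' = 0\<close> covers case III as well.\<close>
  have IV: ?thesis if "case_IV n f xs m' L M G" for m'
    using lip[OF class_F_lipschitz[of "f j" m' L]] that j by (simp add: case_IV_def)
  from assms(1) consider "case_I n f xs m \<beta> M G" | "case_II n f xs L M G"
    | "case_III n f xs L M G" | "case_IV n f xs m L M G" by blast
  then show ?thesis
  proof cases
    case 1
    have "(norm (grad (f j) z))\<^sup>2 \<le> 2 * \<beta>\<^sup>2 + 2 * m\<^sup>2 * (norm z)\<^sup>2" for z
    proof -
      have "(norm (grad (f j) z - m *\<^sub>R z))\<^sup>2 \<le> \<beta>\<^sup>2"
        using 1 j by (intro power_mono) (auto simp: case_I_def)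
      then show ?thesis
        using norm_add_squared_le[of "grad (f j) z - m *\<^sub>R z" "m *\<^sub>R z"]
        by (simp add: power_mult_distrib)
    qed
    then show ?thesis
      by (intro exI[of _ "2 * \<beta>\<^sup>2"] exI[of _ "2 * m\<^sup>2"]) auto
  next
    case 2
    then show ?thesis
      using lip[of L] j by (simp add: case_II_def L_smooth_def)
  qed (use IV case_IV_of_case_III in blast)+
qed

text \<open>In cases I and II each summand has a suitable lower bound. In cases III and IV the bound
  for one summand contains a term linear in \<open>grad (f j) xs\<close>, which disappears only in
  the sum, by stationarity of \<open>xs\<close>.\<close>

lemma quad_form_avg_ge:
  fixes f :: "nat \<Rightarrow> real ^ 'p \<Rightarrow> real"
  assumes cases: "case_I n f xs m \<beta> M G \<or> case_II n f xs L M G \<or>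
           case_III n f xs L M G \<or> case_IV n f xs m L M G"
    and n: "1 \<le> n"
    and stationary: "(\<Sum>j=1..n. grad (f j) xs) = 0"
  shows "- 2 * G\<^sup>2 * real n \<le> (\<Sum>j=1..n. quad_form M (z - xs) (grad (f j) z))"
proof -
  have IV: ?thesis if IV: "case_IV n f xs m' L M G" for m'
  proof -
    have G: "real n * G\<^sup>2 = (\<Sum>j=1..n. (norm (grad (f j) xs))\<^sup>2)"
      using IV n by (simp add: case_IV_def)
    \<comment> \<open>Twice \<open>class_F_ineq\<close> pays for splitting
      \<open>grad (f j) z\<close> at \<open>grad (f j) xs\<close>; the inner product with
      \<open>grad (f j) xs\<close> is left over.\<close>
    have "quad_form M (z - xs) (grad (f j) z) \<ge>
        2 * (L + m') * ((z - xs) \<bullet> grad (f j) xs) - 2 * (norm (grad (f j) xs))\<^sup>2"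
      if j: "j \<in> {1..n}" for j
    proof -
      have "(norm (grad (f j) z - grad (f j) xs))\<^sup>2 \<le>
        (L + m') * ((z - xs) \<bullet> (grad (f j) z - grad (f j) xs)) - m' * L * (norm (z - xs))\<^sup>2"
        using IV j by (intro class_F_ineq) (auto simp: case_IV_def)
      moreover have "M$1$1 = - 2 * m' * L" "M$1$2 = L + m'" "M$2$1 = L + m'" "M$2$2 = -1"
        using IV by (auto simp: case_IV_def)
      ultimately show ?thesis
        using norm_add_squared_le[of "grad (f j) z - grad (f j) xs" "grad (f j) xs"]
        by (simp add: quad_form_def algebra_simps)
    qed
    then have "(\<Sum>j=1..n. quad_form M (z - xs) (grad (f j) z)) \<ge>
       (\<Sum>j=1..n. 2 * (L + m') * ((z - xs) \<bullet> grad (f j) xs) - 2 * (norm (grad (f j) xs))\<^sup>2)"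
      by (rule sum_mono)
    also have "(\<Sum>j=1..n. 2 * (L + m') * ((z - xs) \<bullet> grad (f j) xs) - 2 * (norm (grad (f j) xs))\<^sup>2)
       = - 2 * (real n * G\<^sup>2)"
      unfolding G using stationary
      by (simp add: sum_subtractf sum_distrib_left[symmetric] inner_sum_right[symmetric])
    finally show ?thesis by (simp add: mult.commute mult.left_commute)
  qed
  from cases consider "case_I n f xs m \<beta> M G" | "case_II n f xs L M G"
    | "case_III n f xs L M G" | "case_IV n f xs m L M G" by blast
  then show ?thesis
  proof cases
    case 1
    have "- 2 * G\<^sup>2 \<le> quad_form M (z - xs) (grad (f j) z)" if j: "j \<in> {1..n}" for j
    proof -
      have "(norm (grad (f j) z - m *\<^sub>R z))\<^sup>2 \<le> \<beta>\<^sup>2"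
        using 1 j by (intro power_mono) (auto simp: case_I_def)
      \<comment> \<open>Here \<open>M\<close> is minus the outer product of \<open>(m, -1)\<close>
        with itself, so its form is minus a perfect square.\<close>
      moreover have "quad_form M (z - xs) (grad (f j) z) = - (norm (grad (f j) z - m *\<^sub>R (z - xs)))\<^sup>2"
      proof -
        have "M$1$1 = - m\<^sup>2" "M$1$2 = m" "M$2$1 = m" "M$2$2 = -1"
          using 1 by (auto simp: case_I_def)
        then show ?thesis
          unfolding quad_form_def dot_square_norm[symmetric]
          by (simp add: power2_eq_square inner_commute algebra_simps)
      qed
      \<comment> \<open>The hypothesis is centered at the origin and the form at \<open>xs\<close>;
        the shift \<open>m *\<^sub>R xs\<close> produces the second term of
        \<open>G\<^sup>2\<close>.\<close>
      moreover have "grad (f j) z - m *\<^sub>R (z - xs) = (grad (f j) z - m *\<^sub>R z) + m *\<^sub>R xs"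
        by (simp add: algebra_simps)
      moreover have "G\<^sup>2 = \<beta>\<^sup>2 + m\<^sup>2 * (norm xs)\<^sup>2"
        using 1 by (simp add: case_I_def)
      ultimately show ?thesis
        using norm_add_squared_le[of "grad (f j) z - m *\<^sub>R z" "m *\<^sub>R xs"]
        by (simp add: power_mult_distrib)
    qed
    then have "(\<Sum>j=1..n. - 2 * G\<^sup>2) \<le> (\<Sum>j=1..n. quad_form M (z - xs) (grad (f j) z))"
      by (rule sum_mono)
    then show ?thesis by (simp add: mult.commute)
  next
    case 2
    have G: "real n * G\<^sup>2 = (\<Sum>j=1..n. (norm (grad (f j) xs))\<^sup>2)"
      using 2 n by (simp add: case_II_def)
    have "- 2 * (norm (grad (f j) xs))\<^sup>2 \<le> quad_form M (z - xs) (grad (f j) z)"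
      if j: "j \<in> {1..n}" for j
    proof -
      \<comment> \<open>Twice this bound is offset exactly by the entry \<open>2 * L\<^sup>2\<close>
        of \<open>M\<close>.\<close>
      have "(norm (grad (f j) z - grad (f j) xs))\<^sup>2 \<le> (L * norm (z - xs))\<^sup>2"
        using 2 j by (intro power_mono) (auto simp: case_II_def L_smooth_def)
      then show ?thesis
        using 2 norm_add_squared_le[of "grad (f j) z - grad (f j) xs" "grad (f j) xs"]
        by (simp add: case_II_def quad_form_def power_mult_distrib)
    qed
    then have "(\<Sum>j=1..n. - 2 * (norm (grad (f j) xs))\<^sup>2)
        \<le> (\<Sum>j=1..n. quad_form M (z - xs) (grad (f j) z))"
      by (rule sum_mono)
    then show ?thesis using G by (simp add: sum_distrib_left[symmetric] sum_negf mult.commute)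
  qed (use IV case_IV_of_case_III in blast)+
qed

text \<open>The class only provides some center \<open>xs'\<close>. At the given minimizer the
  gradient vanishes, so the inequality there forces \<open>xs = xs'\<close>.\<close>

lemma class_S_inf_ineq:
  fixes g :: "real ^ 'p \<Rightarrow> real"
  assumes "g \<in> class_S_inf m" and "0 < m" and min: "global_minimizer g xs"
  shows "m * (norm (z - xs))\<^sup>2 \<le> (z - xs) \<bullet> grad g z" and "grad g xs = 0"
proof -
  obtain xs' where xs': "\<And>x. m * (norm (x - xs'))\<^sup>2 \<le> (x - xs') \<bullet> grad g x"
    using assms(1) by (auto simp: class_S_inf_def)
  show 0: "grad g xs = 0"
    using assms(1) min by (intro grad_global_minimizer) (auto simp: class_S_inf_def)
  have "xs = xs'"
    using xs'[of xs] \<open>0 < m\<close> by (simp add: 0 mult_le_0_iff)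
  then show "m * (norm (z - xs))\<^sup>2 \<le> (z - xs) \<bullet> grad g z"
    using xs' by simp
qed

section \<open>Sampling and square integrability along the iteration\<close>

lemma integrable_inner_of_square:
  fixes X Y :: "'a \<Rightarrow> 'b::euclidean_space"
  assumes [measurable]: "X \<in> borel_measurable M" "Y \<in> borel_measurable M"
    and "integrable M (\<lambda>\<omega>. (norm (X \<omega>))\<^sup>2)" "integrable M (\<lambda>\<omega>. (norm (Y \<omega>))\<^sup>2)"
  shows "integrable M (\<lambda>\<omega>. X \<omega> \<bullet> Y \<omega>)"
proof (rule Bochner_Integration.integrable_bound)
  show "integrable M (\<lambda>\<omega>. (norm (X \<omega>))\<^sup>2 + (norm (Y \<omega>))\<^sup>2)"
    using assms by simp
  show "AE \<omega> in M. norm (X \<omega> \<bullet> Y \<omega>) \<le> norm ((norm (X \<omega>))\<^sup>2 + (norm (Y \<omega>))\<^sup>2)"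
  proof (intro AE_I2)
    fix \<omega>
    have "\<bar>X \<omega> \<bullet> Y \<omega>\<bar> \<le> norm (X \<omega>) * norm (Y \<omega>)" by (rule Cauchy_Schwarz_ineq2)
    also have "\<dots> \<le> (norm (X \<omega>))\<^sup>2 + (norm (Y \<omega>))\<^sup>2"
      using sum_squares_bound[of "norm (X \<omega>)" "norm (Y \<omega>)"]
        mult_nonneg_nonneg[OF norm_ge_zero norm_ge_zero, of "X \<omega>" "Y \<omega>"] by linarith
    finally show "norm (X \<omega> \<bullet> Y \<omega>) \<le> norm ((norm (X \<omega>))\<^sup>2 + (norm (Y \<omega>))\<^sup>2)" by simp
  qed
qed measurable

context biased_sgd
begin

lemma i_measurable: "i k \<in> measurable P (count_space {1..n})"
  using i_indep unfolding indep_vars_def by auto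

lemma i_in: "\<omega> \<in> space P \<Longrightarrow> i k \<omega> \<in> {1..n}"
  using measurable_space[OF i_measurable] by simp

text \<open>Independence is a statement about families of events, so \<open>i_indep_x\<close>
  already contains that the preimages under \<open>x k\<close> are events.\<close>

lemma x_measurable: "x k \<in> borel_measurable P"
proof (rule measurableI)
  fix A :: "(real ^ 'p) set" assume "A \<in> sets borel"
  then show "x k -` A \<inter> space P \<in> sets P"
    using i_indep_x[of k] unfolding indep_sets2_eq by blast
qed simp

lemma prob_i: "j \<in> {1..n} \<Longrightarrow> prob (i k -` {j} \<inter> space P) = 1 / real n"
proof -
  assume j: "j \<in> {1..n}"
  have "prob (i k -` {j} \<inter> space P) = measure (distr P (count_space {1..n}) (i k)) {j}"
    using j by (subst measure_distr[OF i_measurable]) auto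
  also have "\<dots> = 1 / real n"
    unfolding i_uniform using j by (subst measure_uniform_count_measure) auto
  finally show ?thesis .
qed

lemma grad_f_measurable: "j \<in> {1..n} \<Longrightarrow> grad (f j) \<in> borel_measurable borel"
  using f_differentiable by (intro borel_measurable_grad) auto

text \<open>This takes the place of conditioning on \<open>x k\<close>: splitting by the finitely
  many values of \<open>i k\<close> gives products of an indicator and a function of
  \<open>x k\<close>, each of which factors with probability \<open>1 / real n\<close>.\<close>

lemma expectation_sample:
  fixes \<phi> :: "nat \<Rightarrow> real ^ 'p \<Rightarrow> real"
  assumes meas: "\<And>j. j \<in> {1..n} \<Longrightarrow> \<phi> j \<in> borel_measurable borel"
    and int: "\<And>j. j \<in> {1..n} \<Longrightarrow> integrable P (\<lambda>\<omega>. \<phi> j (x k \<omega>))"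
  shows "integrable P (\<lambda>\<omega>. \<phi> (i k \<omega>) (x k \<omega>))"
    and "expectation (\<lambda>\<omega>. \<phi> (i k \<omega>) (x k \<omega>)) =
      expectation (\<lambda>\<omega>. (1 / real n) * (\<Sum>j=1..n. \<phi> j (x k \<omega>)))"
proof -
  let ?s = "\<lambda>\<omega>. \<Sum>j=1..n. indicator {j} (i k \<omega>) * \<phi> j (x k \<omega>)"
  have s: "\<phi> (i k \<omega>) (x k \<omega>) = ?s \<omega>" if "\<omega> \<in> space P" for \<omega>
    using i_in[OF that, of k] by (simp add: indicator_def if_distrib cong: if_cong)
  have *: "integrable P (\<lambda>\<omega>. indicator {j} (i k \<omega>) * \<phi> j (x k \<omega>))"
    "expectation (\<lambda>\<omega>. indicator {j} (i k \<omega>) * \<phi> j (x k \<omega>)) = (1 / real n) * expectation (\<lambda>\<omega>. \<phi> j (x k \<omega>))"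
    if j: "j \<in> {1..n}" for j
    using expectation_indicator_mult_indep[OF i_indep_x i_measurable x_measurable meas[OF j] int[OF j],
        of "{j}"] j prob_i[OF j] by simp_all
  have "integrable P ?s"
    using * by (intro Bochner_Integration.integrable_sum) auto
  then show "integrable P (\<lambda>\<omega>. \<phi> (i k \<omega>) (x k \<omega>))"
    using s by (simp cong: Bochner_Integration.integrable_cong)
  have "expectation (\<lambda>\<omega>. \<phi> (i k \<omega>) (x k \<omega>)) = expectation ?s"
    using s by (intro Bochner_Integration.integral_cong) auto
  also have "\<dots> = (\<Sum>j=1..n. (1 / real n) * expectation (\<lambda>\<omega>. \<phi> j (x k \<omega>)))"
    using * by (subst Bochner_Integration.integral_sum) auto
  also have "\<dots> = expectation (\<lambda>\<omega>. (1 / real n) * (\<Sum>j=1..n. \<phi> j (x k \<omega>)))"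
    using int by (simp add: sum_divide_distrib Bochner_Integration.integral_sum)
  finally show "expectation (\<lambda>\<omega>. \<phi> (i k \<omega>) (x k \<omega>)) =
      expectation (\<lambda>\<omega>. (1 / real n) * (\<Sum>j=1..n. \<phi> j (x k \<omega>)))" .
qed

lemma grad_square_integrable:
  assumes growth: "\<exists>A B. \<forall>z. (norm (grad (f j) z))\<^sup>2 \<le> A + B * (norm z)\<^sup>2"
    and j: "j \<in> {1..n}" and int: "integrable P (\<lambda>\<omega>. (norm (x k \<omega>))\<^sup>2)"
  shows "integrable P (\<lambda>\<omega>. (norm (grad (f j) (x k \<omega>)))\<^sup>2)"
proof -
  note [measurable] = x_measurable grad_f_measurable[OF j]
  obtain A B where AB: "\<And>z. (norm (grad (f j) z))\<^sup>2 \<le> A + B * (norm z)\<^sup>2"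
    using growth by blast
  show ?thesis
  proof (rule Bochner_Integration.integrable_bound)
    show "integrable P (\<lambda>\<omega>. A + B * (norm (x k \<omega>))\<^sup>2)"
      using int by simp
    show "AE \<omega> in P. norm ((norm (grad (f j) (x k \<omega>)))\<^sup>2) \<le> norm (A + B * (norm (x k \<omega>))\<^sup>2)"
      using AB by (intro AE_I2) (simp add: order_trans[OF _ abs_ge_self])
  qed measurable
qed

text \<open>A Bochner integral defaults to 0 without integrability, so this is needed for the
  expectations to be meaningful. In the induction, the growth bound handles the gradients at
  \<open>x k\<close>, sampling handles \<open>u k\<close>, and \<open>e_bound\<close> handles
  \<open>e k\<close>.\<close>

lemma x_square_integrable:
  assumes growth: "\<And>j. j \<in> {1..n} \<Longrightarrow>
    \<exists>A B. \<forall>z. (norm (grad (f j) z))\<^sup>2 \<le> A + B * (norm z)\<^sup>2"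
  shows "integrable P (\<lambda>\<omega>. (norm (x k \<omega>))\<^sup>2)"
proof (induction k)
  case 0
  show ?case by (rule x0_square_integrable)
next
  case (Suc k)
  note [measurable] = x_measurable
  have "integrable P (\<lambda>\<omega>. (norm (grad (f (i k \<omega>)) (x k \<omega>)))\<^sup>2)"
  proof (rule expectation_sample(1))
    fix j assume j: "j \<in> {1..n}"
    note [measurable] = grad_f_measurable[OF j]
    show "(\<lambda>z. (norm (grad (f j) z))\<^sup>2) \<in> borel_measurable borel" by measurable
    show "integrable P (\<lambda>\<omega>. (norm (grad (f j) (x k \<omega>)))\<^sup>2)"
      by (rule grad_square_integrable[OF growth[OF j] j Suc.IH])
  qed
  then have u: "integrable P (\<lambda>\<omega>. (norm (u k \<omega>))\<^sup>2)"
    using u_eq by (simp cong: Bochner_Integration.integrable_cong)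
  \<comment> \<open>The majorant comes from \<open>norm_add_squared_le\<close>, applied to the
    update and then to \<open>u k + e k\<close>, followed by \<open>e_bound\<close>.\<close>
  let ?b = "\<lambda>\<omega>. 2 * (norm (x k \<omega>))\<^sup>2 +
    2 * (\<alpha> k)\<^sup>2 * (2 * (norm (u k \<omega>))\<^sup>2 + 2 * (\<delta>\<^sup>2 * (norm (u k \<omega>))\<^sup>2 + c\<^sup>2))"
  have "integrable P ?b"
    using u Suc.IH by simp
  then show ?case
  proof (rule Bochner_Integration.integrable_bound)
    show "AE \<omega> in P. norm ((norm (x (Suc k) \<omega>))\<^sup>2) \<le> norm (?b \<omega>)"
      using e_bound[of k] AE_space
    proof eventually_elim
      fix \<omega> assume e: "(norm (e k \<omega>))\<^sup>2 \<le> \<delta>\<^sup>2 * (norm (u k \<omega>))\<^sup>2 + c\<^sup>2" and \<omega>: "\<omega> \<in> space P"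
      have "(norm (x (Suc k) \<omega>))\<^sup>2 \<le> 2 * (norm (x k \<omega>))\<^sup>2 + 2 * ((\<alpha> k)\<^sup>2 * (norm (u k \<omega> + e k \<omega>))\<^sup>2)"
        using norm_add_squared_le[of "x k \<omega>" "- \<alpha> k *\<^sub>R (u k \<omega> + e k \<omega>)"] x_Suc[OF \<omega>, of k]
        by (simp add: power_mult_distrib)
      also have "(\<alpha> k)\<^sup>2 * (norm (u k \<omega> + e k \<omega>))\<^sup>2 \<le>
          (\<alpha> k)\<^sup>2 * (2 * (norm (u k \<omega>))\<^sup>2 + 2 * (\<delta>\<^sup>2 * (norm (u k \<omega>))\<^sup>2 + c\<^sup>2))"
        using norm_add_squared_le[of "u k \<omega>" "e k \<omega>"] e by (intro mult_left_mono) auto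
      finally show "norm ((norm (x (Suc k) \<omega>))\<^sup>2) \<le> norm (?b \<omega>)" by simp
    qed
  qed measurable
qed

end

section \<open>The one-step recursion\<close>

theorem theorem1:
  fixes P :: "'w measure"
    and n k :: nat
    and f :: "nat \<Rightarrow> real ^ 'p \<Rightarrow> real"
    and \<alpha> :: "nat \<Rightarrow> real"
    and \<delta> c m L \<beta> G lam \<nu> \<mu> \<rho> :: real
    and i :: "nat \<Rightarrow> 'w \<Rightarrow> nat"
    and x u e :: "nat \<Rightarrow> 'w \<Rightarrow> real ^ 'p"
    and xs :: "real ^ 'p"
    and M :: "real ^ 2 ^ 2"
  assumes sgd: "biased_sgd P n f \<alpha> \<delta> c i x u e"
    and m_pos: "0 < m"
    and g_class: "avg_fun n f \<in> class_S_inf m"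
    and xs_min: "global_minimizer (avg_fun n f) xs"
    and cases: "case_I n f xs m \<beta> M G \<or> case_II n f xs L M G \<or>
                case_III n f xs L M G \<or> case_IV n f xs m L M G"
    and nonneg: "0 \<le> lam" "0 \<le> \<nu>" "0 \<le> \<mu>" "0 \<le> \<rho>"
    and lmi: "neg_semidefinite (lmi_matrix M m \<delta> (\<alpha> k) lam \<nu> \<mu> \<rho>)"
  shows "prob_space.expectation P (\<lambda>\<omega>. (norm (x (Suc k) \<omega> - xs))\<^sup>2)
       \<le> \<rho>\<^sup>2 * prob_space.expectation P (\<lambda>\<omega>. (norm (x k \<omega> - xs))\<^sup>2)
         + (2 * lam * G\<^sup>2 + \<mu> * c\<^sup>2)"
proof -
  interpret biased_sgd P n f \<alpha> \<delta> c i x u e by (rule sgd)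
  note x_int = x_square_integrable[OF grad_quadratic_growth[OF cases]]
  note [measurable] = x_measurable
  have grad_g: "grad (avg_fun n f) z = (1 / real n) *\<^sub>R (\<Sum>j=1..n. grad (f j) z)" for z
    using f_differentiable by (intro grad_avg_fun) auto
  have stationary: "(\<Sum>j=1..n. grad (f j) xs) = 0"
    using class_S_inf_ineq(2)[OF g_class m_pos xs_min] n_pos by (simp add: grad_g)
  have y_int: "integrable P (\<lambda>\<omega>. (norm (x l \<omega> - xs))\<^sup>2)" for l
  proof (rule Bochner_Integration.integrable_bound)
    show "integrable P (\<lambda>\<omega>. 2 * (norm (x l \<omega>))\<^sup>2 + 2 * (norm xs)\<^sup>2)"
      using x_int by simp
    show "AE \<omega> in P. norm ((norm (x l \<omega> - xs))\<^sup>2) \<le> norm (2 * (norm (x l \<omega>))\<^sup>2 + 2 * (norm xs)\<^sup>2)"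
      using norm_add_squared_le[of "x l _" "- xs"] by (intro AE_I2) simp
  qed measurable
  \<comment> \<open>With the error term replaced by its bound, the majorant depends only on an index
    and a point, which is the form required by \<open>expectation_sample\<close>.\<close>
  define \<phi> where "\<phi> j z = \<rho>\<^sup>2 * (norm (z - xs))\<^sup>2
      + 2 * \<nu> * (m * (norm (z - xs))\<^sup>2 - (z - xs) \<bullet> grad (f j) z)
      - lam * quad_form M (z - xs) (grad (f j) z) + \<mu> * c\<^sup>2" for j z
  have \<phi>_meas: "\<phi> j \<in> borel_measurable borel" if j: "j \<in> {1..n}" for j
  proof -
    note [measurable] = grad_f_measurable[OF j]
    show ?thesis unfolding \<phi>_def[abs_def] quad_form_def by measurable
  qed
  have \<phi>_int: "integrable P (\<lambda>\<omega>. \<phi> j (x k \<omega>))" if j: "j \<in> {1..n}" for j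
  proof -
    note [measurable] = grad_f_measurable[OF j]
    have g: "integrable P (\<lambda>\<omega>. (norm (grad (f j) (x k \<omega>)))\<^sup>2)"
      by (rule grad_square_integrable[OF grad_quadratic_growth[OF cases j] j x_int])
    have "integrable P (\<lambda>\<omega>. (x k \<omega> - xs) \<bullet> grad (f j) (x k \<omega>))"
      by (rule integrable_inner_of_square[OF _ _ y_int g]) measurable
    with g y_int show ?thesis
      unfolding \<phi>_def quad_form_def by simp
  qed
  \<comment> \<open>This holds at every fixed point \<open>z\<close>, before any expectation: only
    the average over \<open>j\<close> is controlled, not each \<open>\<phi> j z\<close>.\<close>
  have avg: "(1 / real n) * (\<Sum>j=1..n. \<phi> j z) \<le> \<rho>\<^sup>2 * (norm (z - xs))\<^sup>2 + (2 * lam * G\<^sup>2 + \<mu> * c\<^sup>2)" for z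
  proof -
    have S: "m * (norm (z - xs))\<^sup>2 * real n \<le> (\<Sum>j=1..n. (z - xs) \<bullet> grad (f j) z)"
      using class_S_inf_ineq(1)[OF g_class m_pos xs_min, of z] n_pos
      by (simp add: grad_g inner_sum_right field_simps)
    have "(\<Sum>j=1..n. \<phi> j z) = real n * (\<rho>\<^sup>2 * (norm (z - xs))\<^sup>2 + \<mu> * c\<^sup>2)
        + 2 * \<nu> * (m * (norm (z - xs))\<^sup>2 * real n - (\<Sum>j=1..n. (z - xs) \<bullet> grad (f j) z))
        - lam * (\<Sum>j=1..n. quad_form M (z - xs) (grad (f j) z))"
      unfolding \<phi>_def
      by (simp add: sum.distrib sum_subtractf sum_distrib_left[symmetric] algebra_simps)
    also have "\<dots> \<le> real n * (\<rho>\<^sup>2 * (norm (z - xs))\<^sup>2 + \<mu> * c\<^sup>2) + 0 - lam * (- 2 * G\<^sup>2 * real n)"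
      using S quad_form_avg_ge[OF cases n_pos stationary, of z] nonneg
      by (intro diff_mono add_mono order_refl mult_left_mono mult_nonneg_nonpos) auto
    finally show ?thesis
      using n_pos by (simp add: field_simps)
  qed
  \<comment> \<open>The comparison is only almost everywhere because \<open>e_bound\<close>
    is.\<close>
  have "expectation (\<lambda>\<omega>. (norm (x (Suc k) \<omega> - xs))\<^sup>2) \<le> expectation (\<lambda>\<omega>. \<phi> (i k \<omega>) (x k \<omega>))"
  proof (rule integral_mono_AE[OF y_int expectation_sample(1)[OF \<phi>_meas \<phi>_int]])
    show "AE \<omega> in P. (norm (x (Suc k) \<omega> - xs))\<^sup>2 \<le> \<phi> (i k \<omega>) (x k \<omega>)"
      using e_bound[of k] AE_space
    proof eventually_elim
      fix \<omega> assume e: "(norm (e k \<omega>))\<^sup>2 \<le> \<delta>\<^sup>2 * (norm (u k \<omega>))\<^sup>2 + c\<^sup>2" and \<omega>: "\<omega> \<in> space P"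
      have next_eq: "x (Suc k) \<omega> - xs = (x k \<omega> - xs) - \<alpha> k *\<^sub>R (u k \<omega> + e k \<omega>)"
        using x_Suc[OF \<omega>] by simp
      have "\<mu> * ((norm (e k \<omega>))\<^sup>2 - \<delta>\<^sup>2 * (norm (u k \<omega>))\<^sup>2) \<le> \<mu> * c\<^sup>2"
        using e nonneg by (intro mult_left_mono) auto
      then show "(norm (x (Suc k) \<omega> - xs))\<^sup>2 \<le> \<phi> (i k \<omega>) (x k \<omega>)"
        using lmi_vec[OF lmi, of "x k \<omega> - xs" "u k \<omega>" "e k \<omega>"]
        unfolding next_eq \<phi>_def u_eq[OF \<omega>, of k, symmetric] by linarith
    qed
  qed
  also have "\<dots> = expectation (\<lambda>\<omega>. (1 / real n) * (\<Sum>j=1..n. \<phi> j (x k \<omega>)))"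
    by (rule expectation_sample(2)[OF \<phi>_meas \<phi>_int])
  also have "\<dots> \<le> expectation (\<lambda>\<omega>. \<rho>\<^sup>2 * (norm (x k \<omega> - xs))\<^sup>2 + (2 * lam * G\<^sup>2 + \<mu> * c\<^sup>2))"
  proof (rule integral_mono)
    have "integrable P (\<lambda>\<omega>. \<Sum>j=1..n. \<phi> j (x k \<omega>))"
      using \<phi>_int by (rule Bochner_Integration.integrable_sum)
    then show "integrable P (\<lambda>\<omega>. (1 / real n) * (\<Sum>j=1..n. \<phi> j (x k \<omega>)))"
      by (rule integrable_mult_right)
    show "integrable P (\<lambda>\<omega>. \<rho>\<^sup>2 * (norm (x k \<omega> - xs))\<^sup>2 + (2 * lam * G\<^sup>2 + \<mu> * c\<^sup>2))"
      using y_int by simp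
  qed (rule avg)
  also have "\<dots> = \<rho>\<^sup>2 * expectation (\<lambda>\<omega>. (norm (x k \<omega> - xs))\<^sup>2) + (2 * lam * G\<^sup>2 + \<mu> * c\<^sup>2)"
    using y_int by (simp add: prob_space)
  finally show ?thesis .
qed

end
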